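(* Suppose that $F=f+g$ is bounded below; $\nabla f$ is $L$-Lipschitz continuous on $\mathbb{R}^d$ (with $L>0$); $g$ is closed and separable, i.e. $g(\mathbf{x})=\sum_{i=1}^p g_i(x_i)$; there is $s\in\mathbb{N}$ (possibly $0$) such that (bounded delay) for all $i,j,t$, $0\le t-\tau_j^i(t)\le s$ and $\tau_i^i(t)=t$, and (frequent update) for all $i,t$, $T_i\cap\{t,t+1,\ldots,t+s\}\neq\emptyset$; and let $F$ satisfy the Kurdyka-Łojasiewicz (KŁ) property. Let the step size be $\eta\in\left(0,\frac{1}{L(1+2\sqrt{p}\,s)}\right)$, and suppose that the sequence generated by m-PAPG has the sufficient decrease property: there exists $\alpha>0$ such that for all large $t$, $$F(\mathbf{x}(t+1))\le F(\mathbf{x}(t))-\alpha\|\mathbf{x}(t+1)-\mathbf{x}(t)\|^2.$$ Then every bounded sequence $\{\mathbf{x}(t)\}$ generated by m-PAPG satisfies $$\sum_{t=0}^\infty\|\mathbf{x}(t+1)-\mathbf{x}(t)\|<\infty,\qquad \sum_{t=0}^\infty\|\mathbf{x}^i(t+1)-\mathbf{x}^i(t)\|<\infty\quad\text{for all } i=1,\ldots,p.$$ Furthermore, $\{\mathbf{x}(t)\}$ and $\{\mathbf{x}^i(t)\}$, $i=1,\ldots,p$, converge to the same critical point of $F$.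
   Context: Setting. $\mathbb{R}^d=\mathbb{R}^{d_1}\times\cdots\times\mathbb{R}^{d_p}$, $\mathbf{x}=(x_1,\ldots,x_p)$ with $x_i\in\mathbb{R}^{d_i}$; $\|\cdot\|$ is the Euclidean norm. $f:\mathbb{R}^d\to\mathbb{R}$ is differentiable, with $i$-th block of the gradient denoted $\nabla_i f:\mathbb{R}^d\to\mathbb{R}^{d_i}$; $g:\mathbb{R}^d\to(-\infty,+\infty]$ and $g_i:\mathbb{R}^{d_i}\to(-\infty,+\infty]$ are proper (not identically $+\infty$) and closed (all sublevel sets closed). $F=f+g$. Proximal map: $\mathrm{prox}_h^{\eta}(x)=\operatorname{argmin}_z\, h(z)+\frac{1}{2\eta}\|z-x\|^2$; if this set has more than one element, $\mathrm{prox}_h^\eta(x)$ denotes an arbitrary element of it. m-PAPG algorithm. Time is $t=0,1,2,\ldots$. For each machine $i\in\{1,\ldots,p\}$ a set $T_i\subseteq\{0,1,2,\ldots\}$ of active clocks is given, and for all $i,j,t$ an integer $\tau_j^i(t)$ with $0\le\tau_j^i(t)\le t$. From an initial point $\mathbf{x}(0)\in\mathbb{R}^d$ and a step size $\eta>0$, the global sequence $\mathbf{x}(t)=(x_1(t),\ldots,x_p(t))$ and the local sequences $\mathbf{x}^i(t)=(x_1(\tau_1^i(t)),\ldots,x_p(\tau_p^i(t)))$ are generated by: for each $i$, $x_i(t+1)=x_i(t)$ if $t\notin T_i$, and $x_i(t+1)=\mathrm{prox}_{g_i}^{\eta}\big(x_i(t)-\eta\nabla_i f(\mathbf{x}^i(t))\big)$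 if $t\in T_i$. Subdifferential and critical points: for proper closed $h$ and $\mathbf{x}\in\operatorname{dom}h$, the Fréchet subdifferential $\hat\partial h(\mathbf{x})$ is the set of $\mathbf{u}$ with $\liminf_{\mathbf{z}\to\mathbf{x},\mathbf{z}\ne\mathbf{x}}\frac{h(\mathbf{z})-h(\mathbf{x})-\mathbf{u}^\top(\mathbf{z}-\mathbf{x})}{\|\mathbf{z}-\mathbf{x}\|}\ge0$; the limiting subdifferential is $\partial h(\mathbf{x})=\{\mathbf{u}:\exists\,\mathbf{x}^k\to\mathbf{x},\ h(\mathbf{x}^k)\to h(\mathbf{x}),\ \mathbf{u}^k\in\hat\partial h(\mathbf{x}^k),\ \mathbf{u}^k\to\mathbf{u}\}$; critical points are the elements of $\operatorname{crit}h=\{\mathbf{x}:\mathbf{0}\in\partial h(\mathbf{x})\}$. $\mathrm{dist}_\Omega(\mathbf{x})=\min_{\mathbf{y}\in\Omega}\|\mathbf{y}-\mathbf{x}\|$ for closed $\Omega$ (with value $+\infty$ if $\Omega=\emptyset$). KŁ property: $h$ satisfies the KŁ property if for every compact set $\Omega\subset\operatorname{dom}h$ on which $h$ is constant there exist $\varepsilon,\lambda>0$ and a continuous concave function $\varphi:[0,\lambda)\to\mathbb{R}_+$ with $\varphi(0)=0$ and with continuous and positive derivative $\varphi'$ on $(0,\lambda)$, such that for all $\bar{\mathbf{x}}\in\Omega$ and all $\mathbf{x}$ with $\mathrm{dist}_\Omega(\mathbf{x})<\varepsilon$ and $h(\bar{\mathbf{x}})<h(\mathbf{x})<h(\bar{\mathbf{x}})+\lambda$,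 one has $\varphi'(h(\mathbf{x})-h(\bar{\mathbf{x}}))\cdot\mathrm{dist}_{\partial h(\mathbf{x})}(\mathbf{0})\ge1$. *)

theory Defs
  imports "HOL-Analysis.Analysis"
begin

text \<open>
  The \<open>d\<close> coordinates are indexed by \<open>'n\<close>, the \<open>p\<close> blocks by \<open>'p\<close>, and a map
  \<open>blk :: 'n \<Rightarrow> 'p\<close> assigns each coordinate to its block, so that \<open>d\<^sub>i\<close> is the number of
  coordinates mapped to \<open>i\<close>. The space \<open>R^(d\<^sub>i)\<close> is identified isometrically with the
  coordinate subspace \<open>block_space blk i\<close>, and \<open>x\<^sub>i\<close> with \<open>block blk i x\<close>.
\<close>

definition block_space :: "('n \<Rightarrow> 'p) \<Rightarrow> 'p \<Rightarrow> (real ^ 'n) set" where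
  "block_space blk i = {z. \<forall>k. blk k \<noteq> i \<longrightarrow> z $ k = 0}"

definition block :: "('n \<Rightarrow> 'p) \<Rightarrow> 'p \<Rightarrow> real ^ 'n \<Rightarrow> real ^ 'n" where
  "block blk i x = (\<chi> k. if blk k = i then x $ k else 0)"

text \<open>
  The carrier \<open>V\<close> is \<open>UNIV\<close> for functions on the whole space and a block space for the
  components \<open>g\<^sub>i\<close>. Block spaces are closed, so closedness relative to \<open>V\<close> is closedness.
\<close>

definition proper_fun_on :: "'a set \<Rightarrow> ('a \<Rightarrow> ereal) \<Rightarrow> bool" where
  "proper_fun_on V h \<longleftrightarrow> (\<forall>z\<in>V. h z \<noteq> -\<infinity>) \<and> (\<exists>z\<in>V. h z \<noteq> \<infinity>)"

definition closed_fun_on :: "'a::topological_space set \<Rightarrow> ('a \<Rightarrow> ereal) \<Rightarrow> bool" where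
  "closed_fun_on V h \<longleftrightarrow> (\<forall>r::real. closed {z \<in> V. h z \<le> ereal r})"

definition eff_dom :: "('a \<Rightarrow> ereal) \<Rightarrow> 'a set" where
  "eff_dom h = {x. h x < \<infinity>}"

text \<open>The full set of minimisers; an arbitrary choice from it is expressed by membership.\<close>

definition prox_on ::
    "'a::real_normed_vector set \<Rightarrow> ('a \<Rightarrow> ereal) \<Rightarrow> real \<Rightarrow> 'a \<Rightarrow> 'a set" where
  "prox_on V h \<eta> x =
     {z. is_arg_min (\<lambda>z. h z + ereal (1 / (2 * \<eta>) * (norm (z - x))\<^sup>2)) (\<lambda>z. z \<in> V) z}"

definition frechet_subdiff :: "('a::real_inner \<Rightarrow> ereal) \<Rightarrow> 'a \<Rightarrow> 'a set" where
  "frechet_subdiff h x =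
     {u. x \<in> eff_dom h \<and>
         0 \<le> Liminf (at x) (\<lambda>z. (h z - h x - ereal (u \<bullet> (z - x))) / ereal (norm (z - x)))}"

definition limiting_subdiff :: "('a::real_inner \<Rightarrow> ereal) \<Rightarrow> 'a \<Rightarrow> 'a set" where
  "limiting_subdiff h x =
     {u. x \<in> eff_dom h \<and>
         (\<exists>xs us. xs \<longlonglongrightarrow> x \<and> (\<lambda>k. h (xs k)) \<longlonglongrightarrow> h x \<and>
            (\<forall>k. us k \<in> frechet_subdiff h (xs k)) \<and> us \<longlonglongrightarrow> u)}"

definition crit :: "('a::real_inner \<Rightarrow> ereal) \<Rightarrow> 'a set" where
  "crit h = {x. 0 \<in> limiting_subdiff h x}"

text \<open>
  Extended-real-valued, so that the distance to the empty set is \<open>\<infinity>\<close> (the library's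
  \<open>infdist\<close> and \<open>setdist\<close> yield \<open>0\<close> there). For nonempty closed sets in finite dimension
  the infimum is a minimum.
\<close>

definition set_edist :: "'a::real_normed_vector set \<Rightarrow> 'a \<Rightarrow> ereal" where
  "set_edist S x = (INF y\<in>S. ereal (norm (y - x)))"

definition KL_property :: "('a::real_inner \<Rightarrow> ereal) \<Rightarrow> bool" where
  "KL_property h \<longleftrightarrow>
     (\<forall>\<Omega>. compact \<Omega> \<and> \<Omega> \<subseteq> eff_dom h \<and> h constant_on \<Omega> \<longrightarrow>
       (\<exists>\<epsilon> l :: real. \<exists>\<phi> \<phi>' :: real \<Rightarrow> real.
          \<epsilon> > 0 \<and> l > 0 \<and>
          continuous_on {0..<l} \<phi> \<and> concave_on {0..<l} \<phi> \<and>
          (\<forall>r\<in>{0..<l}. \<phi> r \<ge> 0) \<and> \<phi> 0 = 0 \<and>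
          (\<forall>r\<in>{0<..<l}. (\<phi> has_real_derivative \<phi>' r) (at r) \<and> \<phi>' r > 0) \<and>
          continuous_on {0<..<l} \<phi>' \<and>
          (\<forall>xb\<in>\<Omega>. \<forall>x. set_edist \<Omega> x < ereal \<epsilon> \<and> h xb < h x \<and> h x < h xb + ereal l \<longrightarrow>
             ereal (\<phi>' (real_of_ereal (h x - h xb))) * set_edist (limiting_subdiff h x) 0 \<ge> 1)))"

text \<open>
  \<open>\<tau> i j t\<close> is the clock of the copy of block \<open>j\<close> held by machine \<open>i\<close> at time \<open>t\<close>
  (written \<open>\<tau>\<^sub>j\<close> with superscript \<open>i\<close> in the mathematical notation), and \<open>T i\<close> is the set
  of active clocks of machine \<open>i\<close>.
\<close>

definition local_seq ::
    "('n \<Rightarrow> 'p) \<Rightarrow> ('p \<Rightarrow> 'p \<Rightarrow> nat \<Rightarrow> nat) \<Rightarrow> (nat \<Rightarrow> real ^ 'n) \<Rightarrow> 'p \<Rightarrow> nat \<Rightarrow> real ^ 'n" where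
  "local_seq blk \<tau> x i t = (\<chi> k. x (\<tau> i (blk k) t) $ k)"

definition mPAPG ::
    "('n::finite \<Rightarrow> 'p) \<Rightarrow> (real ^ 'n \<Rightarrow> real ^ 'n) \<Rightarrow> ('p \<Rightarrow> real ^ 'n \<Rightarrow> ereal) \<Rightarrow> real \<Rightarrow>
     ('p \<Rightarrow> nat set) \<Rightarrow> ('p \<Rightarrow> 'p \<Rightarrow> nat \<Rightarrow> nat) \<Rightarrow> (nat \<Rightarrow> real ^ 'n) \<Rightarrow> bool" where
  "mPAPG blk Df gs \<eta> T \<tau> x \<longleftrightarrow>
     (\<forall>i t.
        (t \<notin> T i \<longrightarrow> block blk i (x (Suc t)) = block blk i (x t)) \<and>
        (t \<in> T i \<longrightarrow> block blk i (x (Suc t)) \<in>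
           prox_on (block_space blk i) (gs i) \<eta>
             (block blk i (x t) - \<eta> *\<^sub>R block blk i (Df (local_seq blk \<tau> x i t)))))"

end

theory Submission
  imports Defs
begin

text \<open>
  Separability makes \<open>x (t + 1)\<close> a proximal point of the whole of \<open>g\<close>, taken from a point
  assembled from the last forward step of each machine. The optimality condition yields
  \<open>u t\<close> in the subdifferential of \<open>F\<close> at \<open>x t\<close> whose norm is at most a constant times the sum
  of the step lengths \<open>\<delta> r\<close> over the last \<open>2 s + 1\<close> clocks, and the proximal inequality, compared
  at a cluster point, shows that \<open>F\<close> equals the limit \<open>F*\<close> of \<open>F (x t)\<close> on all cluster points.
  The KL inequality near the set of cluster points, concavity of \<open>\<phi>\<close> and sufficient decrease
  then bound \<open>(\<delta> t)\<^sup>2\<close> by a constant times \<open>\<phi> (F (x t) - F*) - \<phi> (F (x (t + 1)) - F*)\<close> times that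
  windowed sum. By AM-GM, weighted so that the window contributes half of the total length,
  the lengths \<open>\<delta> t\<close> are summable.
\<close>

section \<open>Summability from an inequality with a moving window\<close>

text \<open>After exchanging the sums, a fixed \<open>r\<close> is counted once for each
  \<open>n\<close> with \<open>r < n \<le> r + m\<close>, so at most \<open>m\<close> times.\<close>

lemma sum_window_le:
  fixes \<delta> :: "nat \<Rightarrow> real"
  assumes nonneg: "\<And>n. 0 \<le> \<delta> n"
  shows "(\<Sum>n<M. \<Sum>r\<in>{n - m..<n}. \<delta> r) \<le> real m * (\<Sum>r<M. \<delta> r)"
proof -
  have "(\<Sum>n<M. \<Sum>r\<in>{n - m..<n}. \<delta> r) = (\<Sum>n\<in>{..<M}. \<Sum>r\<in>{r\<in>{..<M}. n - m \<le> r \<and> r < n}. \<delta> r)"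
    by (intro sum.cong refl) auto
  also have "\<dots> = (\<Sum>r<M. \<Sum>n\<in>{n\<in>{..<M}. n - m \<le> r \<and> r < n}. \<delta> r)"
    by (rule sum.swap_restrict) auto
  also have "\<dots> \<le> (\<Sum>r<M. real m * \<delta> r)"
  proof (rule sum_mono)
    fix r
    have "{n\<in>{..<M}. n - m \<le> r \<and> r < n} \<subseteq> {r<..r + m}"
      by auto
    then have "card {n\<in>{..<M}. n - m \<le> r \<and> r < n} \<le> m"
      using card_mono[of "{r<..r + m}"] by fastforce
    then show "(\<Sum>n\<in>{n\<in>{..<M}. n - m \<le> r \<and> r < n}. \<delta> r) \<le> real m * \<delta> r"
      by (simp add: mult_right_mono nonneg)
  qed
  finally show ?thesis
    by (simp add: sum_distrib_left)
qed

text \<open>AM-GM bounds \<open>\<delta> n\<close> by a multiple of its window plus a multiple of a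
  difference of \<open>\<psi>\<close>. The differences telescope, and the windows add up to a
  multiple of the total length that can be absorbed on the left.\<close>

lemma summable_of_window_inequality:
  fixes \<delta> \<psi> :: "nat \<Rightarrow> real"
  assumes nonneg: "\<And>n. 0 \<le> \<delta> n" and K: "0 \<le> K"
    and \<psi>_nonneg: "\<And>n. N \<le> n \<Longrightarrow> 0 \<le> \<psi> n"
    and \<psi>_mono: "\<And>n. N \<le> n \<Longrightarrow> \<psi> (Suc n) \<le> \<psi> n"
    and le: "\<And>n. N \<le> n \<Longrightarrow> (\<delta> n)\<^sup>2 \<le> K * (\<psi> n - \<psi> (Suc n)) * (\<Sum>r\<in>{n - m..<n}. \<delta> r)"
  shows "summable \<delta>"
proof -
  \<comment> \<open>At least \<open>m\<close>, so that the windows are absorbed, and positive even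
    if \<open>m = 0\<close>, so that division is safe.\<close>
  define W where "W = real m + 1"
  define A where "A n = (\<Sum>r\<in>{n - m..<n}. \<delta> r)" for n
  define D where "D n = K * (\<psi> n - \<psi> (Suc n))" for n
  \<comment> \<open>Obtained by solving \<open>S \<le> S0 + S / 2 + W * K * \<psi> N / 2\<close> for
    the partial sum \<open>S\<close>, where \<open>S0\<close> is the sum of the first
    \<open>N\<close> terms.\<close>
  define B where "B = 2 * (\<Sum>r<N. \<delta> r) + W * K * \<psi> N"
  have W: "0 < W"
    by (simp add: W_def)
  have am_gm: "a * b \<le> ((a + b) / 2)\<^sup>2" for a b :: real
    using zero_le_power2[of "a - b"] by (simp add: power2_eq_square field_simps)
  have A: "0 \<le> A n" for n
    unfolding A_def by (intro sum_nonneg nonneg)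
  have step: "\<delta> n \<le> A n / (2 * W) + W * D n / 2" if n: "N \<le> n" for n
  proof -
    have D: "0 \<le> D n"
      unfolding D_def using K \<psi>_mono[OF n] by simp
    have eq: "A n / (2 * W) + W * D n / 2 = (A n / W + W * D n) / 2"
      using W by (simp add: field_simps)
    \<comment> \<open>The weight \<open>W\<close> cancels in the product but not in the arithmetic
      mean, where it scales the window down.\<close>
    have "(\<delta> n)\<^sup>2 \<le> (A n / W) * (W * D n)"
      using le[OF n] W by (simp add: A_def D_def mult.commute)
    also have "\<dots> \<le> ((A n / W + W * D n) / 2)\<^sup>2"
      by (rule am_gm)
    finally show ?thesis
      unfolding eq by (rule power2_le_imp_le) (use A[of n] W D in simp)
  qed
  have bound: "(\<Sum>r<M. \<delta> r) \<le> B" if M: "N \<le> M" for M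
  proof -
    have "(\<Sum>n\<in>{N..<M}. D n) = K * (\<psi> N - \<psi> M)"
      unfolding D_def sum_distrib_left[symmetric] using M
      by (induction M rule: dec_induct) (auto simp: algebra_simps)
    also have "\<dots> \<le> K * \<psi> N"
      using K \<psi>_nonneg[OF M] by (intro mult_left_mono) auto
    finally have D: "(\<Sum>n\<in>{N..<M}. D n) \<le> K * \<psi> N" .
    have "(\<Sum>n\<in>{N..<M}. A n) \<le> (\<Sum>n<M. A n)"
      by (rule sum_mono2) (auto simp: A)
    also have "\<dots> \<le> real m * (\<Sum>r<M. \<delta> r)"
      unfolding A_def by (rule sum_window_le[OF nonneg])
    also have "\<dots> \<le> W * (\<Sum>r<M. \<delta> r)"
      by (intro mult_right_mono sum_nonneg nonneg) (simp add: W_def)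
    finally have SA: "(\<Sum>n\<in>{N..<M}. A n) \<le> W * (\<Sum>r<M. \<delta> r)" .
    have "(\<Sum>r<M. \<delta> r) = (\<Sum>r<N. \<delta> r) + (\<Sum>r\<in>{N..<M}. \<delta> r)"
      using M by (metis lessThan_atLeast0 sum.atLeastLessThan_concat zero_le)
    also have "(\<Sum>r\<in>{N..<M}. \<delta> r) \<le> (\<Sum>r\<in>{N..<M}. A r / (2 * W) + W * D r / 2)"
      by (intro sum_mono step) auto
    also have "\<dots> = (\<Sum>r\<in>{N..<M}. A r) / (2 * W) + W * (\<Sum>r\<in>{N..<M}. D r) / 2"
      by (simp add: sum.distrib sum_divide_distrib sum_distrib_left)
    also have "\<dots> \<le> (W * (\<Sum>r<M. \<delta> r)) / (2 * W) + W * (K * \<psi> N) / 2"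
      using SA D W by (intro add_mono divide_right_mono mult_left_mono) auto
    also have "\<dots> = (\<Sum>r<M. \<delta> r) / 2 + W * K * \<psi> N / 2"
      using W by simp
    finally show ?thesis
      unfolding B_def by simp
  qed
  have "(\<Sum>r<M. \<delta> r) \<le> B" for M
  proof -
    have "(\<Sum>r<M. \<delta> r) \<le> (\<Sum>r<max M N. \<delta> r)"
      by (rule sum_mono2) (auto simp: nonneg)
    also have "\<dots> \<le> B"
      by (rule bound) simp
    finally show ?thesis .
  qed
  then show ?thesis
    using nonneg by (intro summableI_nonneg_bounded)
qed

section \<open>Telescoping along a sequence\<close>

lemma norm_diff_le_sum_steps:
  fixes x :: "nat \<Rightarrow> 'a::real_normed_vector"
  assumes "b \<le> a"
  shows "norm (x a - x b) \<le> (\<Sum>r\<in>{b..<a}. norm (x (Suc r) - x r))"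
  using norm_sum[of "\<lambda>r. x (Suc r) - x r" "{b..<a}"] sum_Suc_diff'[OF assms, of x] by simp

lemma convergent_if_summable_steps:
  fixes x :: "nat \<Rightarrow> 'a::banach"
  assumes "summable (\<lambda>t. norm (x (Suc t) - x t))"
  shows "convergent x"
proof -
  have "summable (\<lambda>t. x (Suc t) - x t)"
    using assms by (rule summable_norm_cancel)
  then have "convergent (\<lambda>n. \<Sum>t<n. x (Suc t) - x t)"
    by (simp add: summable_iff_convergent)
  then have "convergent (\<lambda>n. x n - x 0)"
    by (simp add: sum_lessThan_telescope)
  then have "convergent (\<lambda>n. (x n - x 0) + x 0)"
    by (intro convergent_add convergent_const)
  then show ?thesis
    by simp
qed

section \<open>Subgradients of a smooth function plus a function with quadratic minorants\<close>

text \<open>A liminf is nonnegative once the quotient eventually exceeds each negative number.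
  Multiplying out the quotient gives affine minorants with error \<open>e * norm (z - x)\<close>,
  which are free of extended-real division.\<close>

lemma frechet_subdiffI:
  fixes h :: "'a::real_inner \<Rightarrow> ereal"
  assumes hx: "h x = ereal a"
    and ev: "\<And>e. 0 < e \<Longrightarrow> \<forall>\<^sub>F z in at x. ereal (a + u \<bullet> (z - x) - e * norm (z - x)) \<le> h z"
  shows "u \<in> frechet_subdiff h x"
proof -
  have "0 \<le> Liminf (at x) (\<lambda>z. (h z - h x - ereal (u \<bullet> (z - x))) / ereal (norm (z - x)))"
    unfolding le_Liminf_iff
  proof (intro allI impI)
    fix y :: ereal
    assume "y < 0"
    then obtain r where r: "y < ereal r" "ereal r < 0"
      using ereal_dense2 by blast
    then have "0 < - r"
      by simp
    from ev[OF this] show "\<forall>\<^sub>F z in at x. y < (h z - h x - ereal (u \<bullet> (z - x))) / ereal (norm (z - x))"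
      using eventually_neq_at_within[of x x]
    proof eventually_elim
      case (elim z)
      then have n: "0 < norm (z - x)"
        by simp
      show ?case
      proof (cases "h z")
        case (real b)
        then have "r \<le> (b - a - u \<bullet> (z - x)) / norm (z - x)"
          using elim n by (simp add: pos_le_divide_eq)
        then show ?thesis
          using real hx n r(1) by (simp add: less_le_trans)
      next
        case PInf
        then show ?thesis
          using hx n r(1) by auto
      next
        case MInf
        then show ?thesis
          using elim by simp
      qed
    qed
  qed
  then show ?thesis
    using hx by (simp add: frechet_subdiff_def eff_dom_def)
qed

lemma frechet_subset_limiting_subdiff: "frechet_subdiff h x \<subseteq> limiting_subdiff h x"
proof
  fix u
  assume u: "u \<in> frechet_subdiff h x"
  then have "x \<in> eff_dom h"
    by (simp add: frechet_subdiff_def)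
  with u show "u \<in> limiting_subdiff h x"
    unfolding limiting_subdiff_def mem_Collect_eq
    by (intro conjI exI[of _ "\<lambda>_. x"] exI[of _ "\<lambda>_. u"]) auto
qed

text \<open>Both the linearisation error of \<open>f\<close> and the quadratic term are of smaller
  order than \<open>norm (z - y)\<close>, so the gradient and the slope \<open>w\<close> simply
  add.\<close>

lemma frechet_subdiff_add_smooth:
  fixes g :: "'a::real_inner \<Rightarrow> ereal"
  assumes f: "GDERIV f y :> D" and gy: "g y = ereal a" and c: "0 \<le> c"
    and lower: "\<And>z. ereal (a + w \<bullet> (z - y) - c * (norm (z - y))\<^sup>2) \<le> g z"
  shows "D + w \<in> frechet_subdiff (\<lambda>z. ereal (f z) + g z) y"
proof (rule frechet_subdiffI)
  show "ereal (f y) + g y = ereal (f y + a)"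
    by (simp add: gy)
next
  fix e :: real
  assume e: "0 < e"
  have "((\<lambda>z. norm (f z - f y - (z - y) \<bullet> D) / norm (z - y)) \<longlongrightarrow> 0) (at y)"
    using f by (simp add: gderiv_def has_derivative_iff_norm)
  \<comment> \<open>Half of \<open>e\<close> pays for the linearisation error of \<open>f\<close>,
    the other half for the quadratic term.\<close>
  then have 1: "\<forall>\<^sub>F z in at y. norm (f z - f y - (z - y) \<bullet> D) / norm (z - y) < e / 2"
    by (rule order_tendstoD) (use e in simp)
  have "((\<lambda>z. c * norm (z - y)) \<longlongrightarrow> c * norm (y - y)) (at y)"
    by (intro tendsto_intros)
  then have 2: "\<forall>\<^sub>F z in at y. c * norm (z - y) < e / 2"
    by (rule order_tendstoD) (use e in simp)
  from 1 2 eventually_neq_at_within[of y y]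
  show "\<forall>\<^sub>F z in at y. ereal (f y + a + (D + w) \<bullet> (z - y) - e * norm (z - y)) \<le> ereal (f z) + g z"
  proof eventually_elim
    case (elim z)
    then have n: "0 < norm (z - y)"
      by simp
    have "norm (f z - f y - (z - y) \<bullet> D) \<le> e / 2 * norm (z - y)"
      using elim(1) n by (simp add: pos_divide_less_eq)
    then have "- (e / 2 * norm (z - y)) \<le> f z - f y - (z - y) \<bullet> D"
      unfolding real_norm_def by linarith
    moreover have "c * (norm (z - y))\<^sup>2 \<le> e / 2 * norm (z - y)"
      using mult_right_mono[OF less_imp_le[OF elim(2)], of "norm (z - y)"]
      by (simp add: power2_eq_square mult.assoc)
    ultimately have "f y + a + (D + w) \<bullet> (z - y) - e * norm (z - y)
        \<le> f z + (a + w \<bullet> (z - y) - c * (norm (z - y))\<^sup>2)"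
      by (simp add: inner_add_left inner_commute[of D])
    also have "ereal \<dots> \<le> ereal (f z) + g z"
      using lower[of z] by (metis add_left_mono plus_ereal.simps(1))
    finally show ?case
      by simp
  qed
qed

section \<open>Proximal points and separability\<close>

text \<open>Expanding the square around \<open>y\<close> turns global minimality into a quadratic
  minorant of \<open>g\<close> that touches it at \<open>y\<close>. Its slope
  \<open>(1 / \<eta>) *\<^sub>R (v - y)\<close> is the subgradient given by the optimality
  condition.\<close>

lemma prox_on_lower_bound:
  fixes g :: "'a::real_inner \<Rightarrow> ereal"
  assumes y: "y \<in> prox_on UNIV g \<eta> v" and gy: "g y = ereal a" and \<eta>: "0 < \<eta>"
  shows "ereal (a + ((1 / \<eta>) *\<^sub>R (v - y)) \<bullet> (z - y) - 1 / (2 * \<eta>) * (norm (z - y))\<^sup>2) \<le> g z"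
proof -
  have "g y + ereal (1 / (2 * \<eta>) * (norm (y - v))\<^sup>2) \<le> g z + ereal (1 / (2 * \<eta>) * (norm (z - v))\<^sup>2)"
    using y by (auto simp: prox_on_def is_arg_min_def not_less)
  moreover have "(norm (z - v))\<^sup>2 = (norm (y - v))\<^sup>2 - 2 * ((v - y) \<bullet> (z - y)) + (norm (z - y))\<^sup>2"
    by (simp add: power2_norm_eq_inner inner_diff_left inner_diff_right inner_commute algebra_simps)
  moreover have "1 / (2 * \<eta>) * (A - 2 * B + C) = 1 / (2 * \<eta>) * A - 1 / \<eta> * B + 1 / (2 * \<eta>) * C" for A B C
    using \<eta> by (simp add: field_simps)
  ultimately show ?thesis
    using gy by (cases "g z") (auto simp del: times_divide_eq_left)
qed

lemma sum_norm_block: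
  fixes blk :: "'n::finite \<Rightarrow> 'p::finite"
  shows "(\<Sum>i\<in>UNIV. (norm (block blk i z))\<^sup>2) = (norm z)\<^sup>2"
proof -
  have "(norm (block blk i z))\<^sup>2 = (\<Sum>k\<in>UNIV. if blk k = i then (z $ k)\<^sup>2 else 0)" for i
    unfolding power2_norm_eq_inner inner_vec_def block_def
    by (intro sum.cong) (auto simp: power2_eq_square)
  then have "(\<Sum>i\<in>UNIV. (norm (block blk i z))\<^sup>2)
      = (\<Sum>k\<in>UNIV. \<Sum>i\<in>UNIV. if blk k = i then (z $ k)\<^sup>2 else 0)"
    by (simp add: sum.swap[of _ "UNIV :: 'n set"])
  also have "\<dots> = (norm z)\<^sup>2"
    by (simp add: power2_norm_eq_inner inner_vec_def) (simp add: power2_eq_square)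
  finally show ?thesis .
qed

lemma block_diff: "block blk i (y - z) = block blk i y - block blk i z"
  by (simp add: block_def vec_eq_iff)

lemma block_in_block_space: "block blk i z \<in> block_space blk i"
  by (simp add: block_def block_space_def)

text \<open>The proximal objective is itself a sum over blocks, because squared distances are;
  adding up the minimality of the blocks gives minimality of the whole.\<close>

lemma prox_on_separable:
  fixes blk :: "'n::finite \<Rightarrow> 'p::finite"
  assumes sep: "\<And>y. g y = (\<Sum>i\<in>UNIV. gs i (block blk i y))"
    and prox: "\<And>i. block blk i y \<in> prox_on (block_space blk i) (gs i) \<eta> (block blk i v)"
  shows "y \<in> prox_on UNIV g \<eta> v"
proof -
  have split: "g z + ereal (1 / (2 * \<eta>) * (norm (z - v))\<^sup>2)
    = (\<Sum>i\<in>UNIV. gs i (block blk i z) + ereal (1 / (2 * \<eta>) * (norm (block blk i z - block blk i v))\<^sup>2))" for z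
    by (simp add: sep sum.distrib sum_norm_block[of blk "z - v", symmetric] sum_distrib_left
        block_diff del: times_divide_eq_left)
  have "g y + ereal (1 / (2 * \<eta>) * (norm (y - v))\<^sup>2) \<le> g z + ereal (1 / (2 * \<eta>) * (norm (z - v))\<^sup>2)" for z
    unfolding split
    by (rule sum_mono) (use prox in \<open>auto simp: prox_on_def is_arg_min_def not_less block_in_block_space\<close>)
  then show ?thesis
    by (auto simp: prox_on_def is_arg_min_def not_less)
qed

text \<open>The equation is a way of saying that the value is finite, as follows by comparing with a
  point at which \<open>g\<close> is finite.\<close>

lemma prox_on_finite_value:
  assumes g: "proper_fun_on UNIV g" and y: "y \<in> prox_on UNIV g \<eta> v"
  shows "g y = ereal (real_of_ereal (g y))"
proof -
  obtain z where z: "g z \<noteq> \<infinity>"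
    using g by (auto simp: proper_fun_on_def)
  have "g y + ereal (1 / (2 * \<eta>) * (norm (y - v))\<^sup>2) \<le> g z + ereal (1 / (2 * \<eta>) * (norm (z - v))\<^sup>2)"
    using y by (auto simp: prox_on_def is_arg_min_def not_less)
  then have "g y \<noteq> \<infinity>"
    using z by auto
  moreover have "g y \<noteq> - \<infinity>"
    using g by (auto simp: proper_fun_on_def)
  ultimately show ?thesis
    by (cases "g y") auto
qed

section \<open>Function values along convergent sequences\<close>

text \<open>Lower semicontinuity, read off from the closed sublevel sets at heights
  \<open>b + e\<close>.\<close>

lemma closed_fun_on_limit_le:
  fixes g :: "'a::metric_space \<Rightarrow> ereal"
  assumes g: "closed_fun_on UNIV g" and xs: "xs \<longlonglongrightarrow> c"
    and gxs: "\<forall>\<^sub>F n in sequentially. g (xs n) = ereal (G n)" and G: "G \<longlonglongrightarrow> b"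
  shows "g c \<le> ereal b"
proof (rule ereal_le_epsilon2)
  fix e :: real
  assume "0 < e"
  then have "\<forall>\<^sub>F n in sequentially. G n < b + e"
    by (intro order_tendstoD[OF G]) simp
  then have "\<forall>\<^sub>F n in sequentially. xs n \<in> {z \<in> UNIV. g z \<le> ereal (b + e)}"
    using gxs by eventually_elim simp
  moreover have "closed {z \<in> UNIV. g z \<le> ereal (b + e)}"
    by (rule g[unfolded closed_fun_on_def, rule_format])
  ultimately have "c \<in> {z \<in> UNIV. g z \<le> ereal (b + e)}"
    by (intro Lim_in_closed_set[OF _ _ sequentially_bot xs])
  then show "g c \<le> ereal b + ereal e"
    by simp
qed

text \<open>Closedness yields only \<open>g c \<le> b\<close>. The reverse comes from evaluating the
  minorants at \<open>c\<close>: their slopes converge while \<open>c - xs n\<close> vanishes, so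
  only \<open>G n\<close> survives in the limit.\<close>

lemma prox_regular_limit_value:
  fixes g :: "'a::real_inner \<Rightarrow> ereal"
  assumes g: "closed_fun_on UNIV g" and xs: "xs \<longlonglongrightarrow> c"
    and gxs: "\<forall>\<^sub>F n in sequentially. g (xs n) = ereal (G n)" and G: "G \<longlonglongrightarrow> b"
    and ws: "ws \<longlonglongrightarrow> w"
    and lower: "\<forall>\<^sub>F n in sequentially.
      ereal (G n + ws n \<bullet> (c - xs n) - a * (norm (c - xs n))\<^sup>2) \<le> g c"
  shows "g c = ereal b"
proof (rule antisym)
  show "g c \<le> ereal b"
    by (rule closed_fun_on_limit_le[OF g xs gxs G])
  have "(\<lambda>n. G n + ws n \<bullet> (c - xs n) - a * (norm (c - xs n))\<^sup>2)
      \<longlonglongrightarrow> b + w \<bullet> (c - c) - a * (norm (c - c))\<^sup>2"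
    by (intro tendsto_intros G ws xs)
  then have "(\<lambda>n. ereal (G n + ws n \<bullet> (c - xs n) - a * (norm (c - xs n))\<^sup>2)) \<longlonglongrightarrow> ereal b"
    by simp
  then show "ereal b \<le> g c"
    by (rule tendsto_upperbound[OF _ lower]) simp
qed

section \<open>Cluster points of a bounded sequence\<close>

text \<open>As an intersection of closed tails, the set is visibly closed; its points are the limits
  along index sequences tending to infinity.\<close>

definition cluster_points :: "(nat \<Rightarrow> 'a::metric_space) \<Rightarrow> 'a set" where
  "cluster_points x = (\<Inter>n. closure (x ` {n..}))"

text \<open>The indices are chosen with \<open>n \<le> r n\<close>, hence tend to infinity, which is
  all that the limits of composed sequences require; they may repeat.\<close>

lemma cluster_points_subsequence:
  assumes "c \<in> cluster_points x"
  obtains r where "filterlim r at_top sequentially" "(\<lambda>n. x (r n)) \<longlonglongrightarrow> c"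
proof -
  have "\<exists>t\<ge>n. dist (x t) c < inverse (real (Suc n))" for n
  proof -
    have "c \<in> closure (x ` {n..})"
      using assms by (auto simp: cluster_points_def)
    moreover have "0 < inverse (real (Suc n))"
      by simp
    ultimately have "\<exists>y\<in>x ` {n..}. dist y c < inverse (real (Suc n))"
      unfolding closure_approachable by blast
    then show ?thesis
      by blast
  qed
  then have "\<exists>r. \<forall>n. n \<le> r n \<and> dist (x (r n)) c < inverse (real (Suc n))"
    by (intro choice) blast
  then obtain r where r: "\<And>n. n \<le> r n" "\<And>n. dist (x (r n)) c < inverse (real (Suc n))"
    by blast
  have "filterlim r at_top sequentially"
    by (rule filterlim_at_top_mono[OF filterlim_ident]) (simp add: r)
  moreover have "(\<lambda>n. dist (x (r n)) c) \<longlonglongrightarrow> 0"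
    by (rule tendsto_sandwich[OF _ _ tendsto_const LIMSEQ_inverse_real_of_nat])
      (use r(2) in \<open>auto intro!: always_eventually less_imp_le simp del: of_nat_Suc\<close>)
  then have "(\<lambda>n. x (r n)) \<longlonglongrightarrow> c"
    by (rule tendsto_dist_iff[THEN iffD2])
  ultimately show ?thesis
    by (rule that)
qed

lemma subsequence_limit_in_cluster_points:
  assumes r: "filterlim r at_top sequentially" and lim: "(\<lambda>n. x (r n)) \<longlonglongrightarrow> c"
  shows "c \<in> cluster_points x"
  unfolding cluster_points_def
proof
  fix n
  have "\<forall>\<^sub>F k in sequentially. x (r k) \<in> closure (x ` {n..})"
    using filterlim_at_top[THEN iffD1, OF r, rule_format, of n]
    by eventually_elim (auto intro: closure_subset[THEN subsetD])
  then show "c \<in> closure (x ` {n..})"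
    by (rule Lim_in_closed_set[OF closed_closure _ sequentially_bot lim])
qed

lemma compact_cluster_points:
  fixes x :: "nat \<Rightarrow> 'a::heine_borel"
  assumes "bounded (range x)"
  shows "compact (cluster_points x)"
proof -
  have "cluster_points x \<subseteq> closure (range x)"
    unfolding cluster_points_def by (metis INT_lower UNIV_I atLeast_0)
  then have "bounded (cluster_points x)"
    by (rule bounded_subset[OF bounded_closure[OF assms]])
  moreover have "closed (cluster_points x)"
    unfolding cluster_points_def by (intro closed_INT ballI closed_closure)
  ultimately show ?thesis
    by (simp add: compact_eq_bounded_closed)
qed

text \<open>Otherwise some terms of arbitrarily large index stay away from all cluster points; by
  boundedness a subsequence of these converges, and its limit is a cluster point.\<close>

lemma eventually_near_cluster_points:
  fixes x :: "nat \<Rightarrow> 'a::heine_borel"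
  assumes b: "bounded (range x)" and e: "0 < e"
  shows "\<forall>\<^sub>F t in sequentially. \<exists>c\<in>cluster_points x. dist (x t) c < e"
proof (rule ccontr)
  define far where "far t \<longleftrightarrow> (\<forall>c\<in>cluster_points x. e \<le> dist (x t) c)" for t
  assume "\<not> ?thesis"
  then have "\<exists>t\<ge>n. far t" for n
    unfolding eventually_sequentially far_def not_ex not_all not_imp ball_simps bex_simps not_less by blast
  then have "\<exists>r. \<forall>n. n \<le> r n \<and> far (r n)"
    by (intro choice) blast
  then obtain r where r: "\<And>n. n \<le> r n" "\<And>n. far (r n)"
    by blast
  have r_lim: "filterlim r at_top sequentially"
    by (rule filterlim_at_top_mono[OF filterlim_ident]) (simp add: r)
  have "bounded (range (\<lambda>n. x (r n)))"
    by (rule bounded_subset[OF b]) auto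
  then obtain c k where k: "strict_mono k" and lim: "((\<lambda>n. x (r n)) \<circ> k) \<longlonglongrightarrow> c"
    using bounded_imp_convergent_subsequence[of "\<lambda>n. x (r n)"] by blast
  have lim': "(\<lambda>n. x (r (k n))) \<longlonglongrightarrow> c"
    using lim by (simp only: o_def)
  have "filterlim (\<lambda>n. r (k n)) at_top sequentially"
    by (rule filterlim_compose[OF r_lim filterlim_subseq[OF k]])
  then have c: "c \<in> cluster_points x"
    using lim' by (rule subsequence_limit_in_cluster_points)
  obtain n where "dist (x (r (k n))) c < e"
    using eventually_happens'[OF sequentially_bot tendstoD[OF lim' e]] by blast
  then show False
    using r(2)[of "k n"] c unfolding far_def by (simp add: not_le[symmetric])
qed

section \<open>Concavity and the KL inequality\<close>

lemma concave_on_le_tangent: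
  fixes \<phi> :: "real \<Rightarrow> real"
  assumes "concave_on A \<phi>" "connected A" "c \<in> interior A" "y \<in> A"
    and "(\<phi> has_real_derivative d) (at c)"
  shows "\<phi> y \<le> \<phi> c + d * (y - c)"
proof -
  have "((\<lambda>z. - \<phi> z) has_real_derivative - d) (at c within A)"
    by (rule has_field_derivative_at_within[OF DERIV_minus[OF assms(5)]])
  moreover have "convex_on A (\<lambda>z. - \<phi> z)"
    using assms(1) by (simp only: concave_on_def)
  ultimately have "- d * (y - c) \<le> - \<phi> y - - \<phi> c"
    using convex_on_imp_above_tangent[where f = "\<lambda>z. - \<phi> z"] assms(2-4) by blast
  then show ?thesis
    by simp
qed

lemma sum_window_tendsto_0:
  fixes \<delta> :: "nat \<Rightarrow> real"
  assumes "\<delta> \<longlonglongrightarrow> 0"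
  shows "(\<lambda>n. \<Sum>r\<in>{n - m..<n}. \<delta> r) \<longlonglongrightarrow> 0"
proof -
  have "(\<lambda>n. \<Sum>j<m. \<delta> (n + j)) \<longlonglongrightarrow> (\<Sum>j<m. 0)"
    by (intro tendsto_sum LIMSEQ_ignore_initial_segment assms)
  moreover have "(\<Sum>r\<in>{(n + m) - m..<n + m}. \<delta> r) = (\<Sum>j<m. \<delta> (n + j))" for n
    using sum.shift_bounds_nat_ivl[of \<delta> 0 n m]
    by (simp add: lessThan_atLeast0 add.commute)
  ultimately have "(\<lambda>n. \<Sum>r\<in>{(n + m) - m..<n + m}. \<delta> r) \<longlonglongrightarrow> 0"
    by simp
  then show ?thesis
    by (rule LIMSEQ_offset)
qed

text \<open>Meant for consecutive gaps \<open>p\<close>, \<open>q\<close> between function value and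
  limit value, with \<open>w\<close> the norm of a subgradient. The tangent at \<open>p\<close>
  shows that \<open>\<phi>\<close> drops by at least \<open>\<phi>' p * (p - q)\<close>, and the
  slope condition turns this into a bound on \<open>p - q\<close>.\<close>

lemma concave_desingularization_step:
  fixes \<phi> \<phi>' :: "real \<Rightarrow> real"
  assumes conc: "concave_on {0..<l} \<phi>"
    and deriv: "\<And>r. r \<in> {0<..<l} \<Longrightarrow> (\<phi> has_real_derivative \<phi>' r) (at r) \<and> \<phi>' r > 0"
    and q: "0 \<le> q" "q \<le> p" and p: "p < l" and w: "0 \<le> w"
    and slope: "0 < p \<Longrightarrow> 1 \<le> \<phi>' p * w"
  shows "\<phi> q \<le> \<phi> p" "p - q \<le> (\<phi> p - \<phi> q) * w"
proof -
  have "\<phi> q \<le> \<phi> p \<and> p - q \<le> (\<phi> p - \<phi> q) * w"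
  proof (cases "0 < p")
    \<comment> \<open>A vanishing gap, where no slope is available, means that the limit value is
      already attained.\<close>
    case False
    with q have "p = q"
      by simp
    then show ?thesis
      by simp
  next
    case True
    with p have pl: "p \<in> {0<..<l}"
      by simp
    have "p \<in> interior {0..<l}"
      by (rule interiorI[OF open_greaterThanLessThan pl]) auto
    then have "\<phi> q \<le> \<phi> p + \<phi>' p * (q - p)"
      using concave_on_le_tangent[OF conc] deriv[OF pl] q p by auto
    then have tangent: "\<phi>' p * (p - q) \<le> \<phi> p - \<phi> q"
      by (simp add: algebra_simps)
    moreover have "0 \<le> \<phi>' p * (p - q)"
      using deriv[OF pl] q by simp
    moreover have "p - q \<le> (\<phi>' p * w) * (p - q)"
      using mult_right_mono[OF slope[OF True], of "p - q"] q by simp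
    moreover have "(\<phi>' p * (p - q)) * w \<le> (\<phi> p - \<phi> q) * w"
      by (rule mult_right_mono[OF tangent w])
    ultimately show ?thesis
      by (simp add: mult_ac)
  qed
  then show "\<phi> q \<le> \<phi> p" "p - q \<le> (\<phi> p - \<phi> q) * w"
    by auto
qed

text \<open>The distance to the subdifferential is at most the norm of any one element, so the KL
  inequality passes to a known subgradient.\<close>

lemma KL_slope_bound:
  assumes le: "1 \<le> ereal c * set_edist (limiting_subdiff h y) 0" and c: "0 < c"
    and u: "u \<in> limiting_subdiff h y"
  shows "1 \<le> c * norm u"
proof -
  have "set_edist (limiting_subdiff h y) 0 \<le> ereal (norm (u - 0))"
    unfolding set_edist_def by (rule INF_lower[OF u])
  then have "ereal c * set_edist (limiting_subdiff h y) 0 \<le> ereal c * ereal (norm u)"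
    using c by (intro ereal_mult_left_mono) auto
  with le have "1 \<le> ereal c * ereal (norm u)"
    by (rule order_trans)
  then show ?thesis
    by simp
qed

lemma KL_propertyE:
  assumes KL: "KL_property h" and \<Omega>: "compact \<Omega>" "\<Omega> \<subseteq> eff_dom h" "h constant_on \<Omega>"
  obtains \<epsilon> l \<phi> \<phi>' where "0 < \<epsilon>" "0 < l" "concave_on {0..<l} \<phi>" "\<forall>r\<in>{0..<l}. 0 \<le> \<phi> r"
    "\<forall>r\<in>{0<..<l}. (\<phi> has_real_derivative \<phi>' r) (at r) \<and> \<phi>' r > 0"
    "\<forall>xb\<in>\<Omega>. \<forall>y. set_edist \<Omega> y < ereal \<epsilon> \<and> h xb < h y \<and> h y < h xb + ereal l \<longrightarrow>
      1 \<le> ereal (\<phi>' (real_of_ereal (h y - h xb))) * set_edist (limiting_subdiff h y) 0"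
  using KL[unfolded KL_property_def, THEN spec, THEN mp, OF conjI[OF \<Omega>(1) conjI[OF \<Omega>(2,3)]]]
  by (elim exE conjE) (rule that; assumption)

section \<open>Convergence of a descent sequence with windowed subgradient bounds\<close>

text \<open>This form is detached from the algorithm: a proximal step enters only through its
  quadratic minorant with slope \<open>w t\<close> and the bound on \<open>Df (x t) + w t\<close>.
  All conditions start at \<open>N\<close>, since decrease and proximal representation are available
  only for late clocks.\<close>

lemma KL_descent_convergence:
  fixes x w :: "nat \<Rightarrow> 'a::euclidean_space" and G :: "nat \<Rightarrow> real"
  assumes grad: "\<And>y. GDERIV f y :> Df y" and Df_cont: "continuous_on UNIV Df"
    and g_closed: "closed_fun_on UNIV g" and F_def: "F = (\<lambda>y. ereal (f y) + g y)"
    and bdd_below: "\<And>y. ereal b \<le> F y" and KL: "KL_property F"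
    and bdd: "bounded (range x)" and \<alpha>: "0 < \<alpha>" and C: "0 \<le> C" and a: "0 \<le> a"
    and gx: "\<And>t. N \<le> t \<Longrightarrow> g (x t) = ereal (G t)"
    and decrease: "\<And>t. N \<le> t \<Longrightarrow>
      F (x (Suc t)) \<le> F (x t) - ereal (\<alpha> * (norm (x (Suc t) - x t))\<^sup>2)"
    and lower: "\<And>t z. N \<le> t \<Longrightarrow>
      ereal (G t + w t \<bullet> (z - x t) - a * (norm (z - x t))\<^sup>2) \<le> g z"
    and small: "\<And>t. N \<le> t \<Longrightarrow>
      norm (Df (x t) + w t) \<le> C * (\<Sum>r\<in>{t - m..<t}. norm (x (Suc r) - x r))"
  shows "summable (\<lambda>t. norm (x (Suc t) - x t)) \<and> (\<exists>c\<in>crit F. x \<longlonglongrightarrow> c)"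
proof -
  define \<delta> where "\<delta> t = norm (x (Suc t) - x t)" for t
  define \<Phi> where "\<Phi> t = f (x t) + G t" for t
  define u where "u t = Df (x t) + w t" for t
  have Fx: "F (x t) = ereal (\<Phi> t)" if "N \<le> t" for t
    using gx[OF that] by (simp add: F_def \<Phi>_def)
  have dec: "\<alpha> * (\<delta> t)\<^sup>2 \<le> \<Phi> t - \<Phi> (Suc t)" if "N \<le> t" for t
    using decrease[OF that] that by (simp add: Fx \<delta>_def)
  have \<Phi>_mono: "\<Phi> (Suc t) \<le> \<Phi> t" if "N \<le> t" for t
    using dec[OF that] \<alpha> by (smt (verit) mult_nonneg_nonneg zero_le_power2)
  have "decseq (\<lambda>n. \<Phi> (n + N))"
    by (intro decseq_SucI) (simp add: \<Phi>_mono)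
  moreover have "b \<le> \<Phi> (n + N)" for n
    using bdd_below[of "x (n + N)"] by (simp add: Fx)
  ultimately obtain Fs where "(\<lambda>n. \<Phi> (n + N)) \<longlonglongrightarrow> Fs" and Fs_le: "\<And>n. Fs \<le> \<Phi> (n + N)"
    using decseq_convergent[of "\<lambda>n. \<Phi> (n + N)" b] by metis
  then have \<Phi>_lim: "\<Phi> \<longlonglongrightarrow> Fs"
    by (blast intro: LIMSEQ_offset)
  have Fs: "Fs \<le> \<Phi> t" if "N \<le> t" for t
    using Fs_le[of "t - N"] that by simp
  \<comment> \<open>Consecutive values have the same limit, so sufficient decrease forces the
    squared step lengths to 0.\<close>
  have "(\<lambda>t. (\<Phi> t - \<Phi> (Suc t)) / \<alpha>) \<longlonglongrightarrow> (Fs - Fs) / \<alpha>"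
    using \<alpha> by (intro tendsto_intros \<Phi>_lim LIMSEQ_Suc) auto
  then have "(\<lambda>t. (\<delta> t)\<^sup>2) \<longlonglongrightarrow> 0"
    by (intro Lim_null_comparison[of "\<lambda>t. (\<delta> t)\<^sup>2" "\<lambda>t. (\<Phi> t - \<Phi> (Suc t)) / \<alpha>"])
      (use \<alpha> dec in \<open>auto simp: eventually_sequentially pos_le_divide_eq mult.commute\<close>)
  then have "(\<lambda>t. sqrt ((\<delta> t)\<^sup>2)) \<longlonglongrightarrow> sqrt 0"
    by (rule tendsto_real_sqrt)
  then have \<delta>_lim: "\<delta> \<longlonglongrightarrow> 0"
    by (simp add: \<delta>_def[abs_def])
  have "(\<lambda>t. C * (\<Sum>r\<in>{t - m..<t}. \<delta> r)) \<longlonglongrightarrow> C * 0"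
    by (intro tendsto_mult_left sum_window_tendsto_0 \<delta>_lim)
  then have u_lim: "u \<longlonglongrightarrow> 0"
    by (intro Lim_null_comparison[of u "\<lambda>t. C * (\<Sum>r\<in>{t - m..<t}. \<delta> r)"])
      (use small in \<open>auto simp: eventually_sequentially u_def \<delta>_def\<close>)
  have f_cont: "continuous_on UNIV f"
    using grad by (intro continuous_at_imp_continuous_on ballI has_derivative_continuous)
      (auto simp: gderiv_def)
  \<comment> \<open>A general index map \<open>r\<close> covers cluster points as well as, with the
    identity, the limit of the whole sequence. The slopes \<open>w\<close> converge along
    \<open>r\<close> because \<open>u\<close> tends to 0 and \<open>Df\<close> is
    continuous.\<close>
  have limit_value: "F c = ereal Fs"
    if r: "filterlim r at_top sequentially" and lim: "(\<lambda>n. x (r n)) \<longlonglongrightarrow> c" for r c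
  proof -
    have ev: "\<forall>\<^sub>F n in sequentially. N \<le> r n"
      using r by (simp add: filterlim_at_top)
    have "(\<lambda>n. Df (x (r n))) \<longlonglongrightarrow> Df c"
      by (rule continuous_on_tendsto_compose[OF Df_cont lim]) auto
    then have w_lim: "(\<lambda>n. u (r n) - Df (x (r n))) \<longlonglongrightarrow> 0 - Df c"
      by (intro tendsto_diff filterlim_compose[OF u_lim r])
    have "(\<lambda>n. f (x (r n))) \<longlonglongrightarrow> f c"
      by (rule continuous_on_tendsto_compose[OF f_cont lim]) auto
    then have "(\<lambda>n. \<Phi> (r n) - f (x (r n))) \<longlonglongrightarrow> Fs - f c"
      by (intro tendsto_diff filterlim_compose[OF \<Phi>_lim r])
    then have G_lim: "(\<lambda>n. G (r n)) \<longlonglongrightarrow> Fs - f c"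
      by (simp add: \<Phi>_def)
    have "g c = ereal (Fs - f c)"
      by (rule prox_regular_limit_value[OF g_closed lim _ G_lim w_lim, of a])
        (use ev in eventually_elim, use gx lower[of _ c] in \<open>auto simp: u_def\<close>)+
    then show ?thesis
      by (simp add: F_def)
  qed
  define \<Omega> where "\<Omega> = cluster_points x"
  have \<Omega>: "F c = ereal Fs" if "c \<in> \<Omega>" for c
    using that unfolding \<Omega>_def by (metis cluster_points_subsequence limit_value)
  \<comment> \<open>With \<open>F\<close> constant on the compact set \<open>\<Omega>\<close>, a
    single \<open>\<phi>\<close> serves all cluster points.\<close>
  have "compact \<Omega>" "\<Omega> \<subseteq> eff_dom F" "F constant_on \<Omega>"
    using compact_cluster_points[OF bdd] \<Omega> by (auto simp: \<Omega>_def eff_dom_def constant_on_def)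
  then obtain \<epsilon> l \<phi> \<phi>' where \<epsilon>: "0 < \<epsilon>" and l: "0 < l"
    and conc: "concave_on {0..<l} \<phi>" and \<phi>_nonneg: "\<forall>r\<in>{0..<l}. 0 \<le> \<phi> r"
    and deriv: "\<forall>r\<in>{0<..<l}. (\<phi> has_real_derivative \<phi>' r) (at r) \<and> \<phi>' r > 0"
    and ineq: "\<forall>xb\<in>\<Omega>. \<forall>y. set_edist \<Omega> y < ereal \<epsilon> \<and> F xb < F y \<and> F y < F xb + ereal l \<longrightarrow>
      1 \<le> ereal (\<phi>' (real_of_ereal (F y - F xb))) * set_edist (limiting_subdiff F y) 0"
    by (rule KL_propertyE[OF KL])
  have "\<forall>\<^sub>F t in sequentially. \<exists>c\<in>\<Omega>. dist (x t) c < \<epsilon>"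
    unfolding \<Omega>_def by (rule eventually_near_cluster_points[OF bdd \<epsilon>])
  moreover have "\<forall>\<^sub>F t in sequentially. \<Phi> t < Fs + l"
    using order_tendstoD(2)[OF \<Phi>_lim, of "Fs + l"] l by simp
  moreover have "\<forall>\<^sub>F t in sequentially. N \<le> t"
    by (rule eventually_ge_at_top)
  ultimately have "\<forall>\<^sub>F t in sequentially. (\<exists>c\<in>\<Omega>. dist (x t) c < \<epsilon>) \<and> \<Phi> t < Fs + l \<and> N \<le> t"
    by eventually_elim blast
  then obtain M where near: "\<And>t. M \<le> t \<Longrightarrow> \<exists>c\<in>\<Omega>. dist (x t) c < \<epsilon>"
    and \<Phi>_less: "\<And>t. M \<le> t \<Longrightarrow> \<Phi> t < Fs + l" and MN: "\<And>t. M \<le> t \<Longrightarrow> N \<le> t"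
    unfolding eventually_sequentially by blast
  have frechet: "u t \<in> frechet_subdiff F (x t)" if "N \<le> t" for t
    unfolding u_def F_def
    by (rule frechet_subdiff_add_smooth[OF grad gx[OF that] a lower[OF that]])
  \<comment> \<open>The KL inequality concerns only values strictly above the one on
    \<open>\<Omega>\<close>, hence the positive gap. The base point \<open>c\<close> may be any
    cluster point, as all have the value \<open>Fs\<close>.\<close>
  have slope: "1 \<le> \<phi>' (\<Phi> t - Fs) * norm (u t)" if t: "M \<le> t" and pos: "0 < \<Phi> t - Fs" for t
  proof (rule KL_slope_bound)
    obtain c where c: "c \<in> \<Omega>" "dist (x t) c < \<epsilon>"
      using near[OF t] by blast
    have "set_edist \<Omega> (x t) \<le> ereal (norm (c - x t))"
      unfolding set_edist_def by (rule INF_lower[OF c(1)])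
    also have "\<dots> < ereal \<epsilon>"
      using c(2) by (simp add: dist_norm norm_minus_commute)
    finally have "1 \<le> ereal (\<phi>' (real_of_ereal (F (x t) - F c))) * set_edist (limiting_subdiff F (x t)) 0"
      using pos \<Phi>_less[OF t]
      by (intro ineq[THEN bspec, OF c(1), THEN spec, THEN mp] conjI) (auto simp: Fx[OF MN[OF t]] \<Omega>[OF c(1)])
    then show "1 \<le> ereal (\<phi>' (\<Phi> t - Fs)) * set_edist (limiting_subdiff F (x t)) 0"
      by (simp add: Fx[OF MN[OF t]] \<Omega>[OF c(1)])
    show "0 < \<phi>' (\<Phi> t - Fs)"
      using deriv[THEN bspec, of "\<Phi> t - Fs"] pos \<Phi>_less[OF t] by simp
    show "u t \<in> limiting_subdiff F (x t)"
      using frechet[OF MN[OF t]] frechet_subset_limiting_subdiff by blast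
  qed
  define \<psi> where "\<psi> t = \<phi> (\<Phi> t - Fs)" for t
  have step: "\<psi> (Suc t) \<le> \<psi> t" "\<Phi> t - \<Phi> (Suc t) \<le> (\<psi> t - \<psi> (Suc t)) * norm (u t)" if t: "M \<le> t" for t
    using concave_desingularization_step[OF conc deriv[THEN bspec], of "\<Phi> (Suc t) - Fs" "\<Phi> t - Fs" "norm (u t)"]
      Fs[of "Suc t"] \<Phi>_mono[of t] \<Phi>_less[OF t] slope[OF t] MN[OF t] by (auto simp: \<psi>_def)
  have "summable \<delta>"
  proof (rule summable_of_window_inequality)
    show "0 \<le> \<delta> n" for n
      by (simp add: \<delta>_def)
    \<comment> \<open>\<open>C\<close> comes from the subgradient bound and \<open>\<alpha>\<close>
      from sufficient decrease.\<close>
    show "0 \<le> C / \<alpha>"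
      using C \<alpha> by simp
    show "0 \<le> \<psi> n" if n: "M \<le> n" for n
      unfolding \<psi>_def using Fs[OF MN[OF n]] \<Phi>_less[OF n] by (intro \<phi>_nonneg[THEN bspec]) simp
    show "\<psi> (Suc n) \<le> \<psi> n" if "M \<le> n" for n
      using step(1)[OF that] .
    show "(\<delta> n)\<^sup>2 \<le> C / \<alpha> * (\<psi> n - \<psi> (Suc n)) * (\<Sum>r\<in>{n - m..<n}. \<delta> r)" if n: "M \<le> n" for n
    proof -
      have "\<alpha> * (\<delta> n)\<^sup>2 \<le> (\<psi> n - \<psi> (Suc n)) * norm (u n)"
        using dec[OF MN[OF n]] step(2)[OF n] by simp
      also have "\<dots> \<le> (\<psi> n - \<psi> (Suc n)) * (C * (\<Sum>r\<in>{n - m..<n}. \<delta> r))"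
        using small[OF MN[OF n]] step(1)[OF n] by (intro mult_left_mono) (auto simp: u_def \<delta>_def)
      finally show ?thesis
        using \<alpha> by (simp add: field_simps)
    qed
  qed
  then have summable: "summable (\<lambda>t. norm (x (Suc t) - x t))"
    by (simp add: \<delta>_def[abs_def])
  then obtain c where c: "x \<longlonglongrightarrow> c"
    using convergent_if_summable_steps convergentD by blast
  have Fc: "F c = ereal Fs"
    by (rule limit_value[OF filterlim_ident c])
  \<comment> \<open>The limiting subdifferential asks for subgradients at every index and for
    convergent values; the shift by \<open>N\<close> skips the clocks at which these are not
    known.\<close>
  have F_lim: "(\<lambda>k. F (x (k + N))) \<longlonglongrightarrow> F c"
    using LIMSEQ_ignore_initial_segment[OF \<Phi>_lim, of N] by (simp add: Fx Fc)
  have "c \<in> eff_dom F"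
    by (simp add: eff_dom_def Fc)
  moreover have "\<forall>k. u (k + N) \<in> frechet_subdiff F (x (k + N))"
    by (simp add: frechet)
  ultimately have "0 \<in> limiting_subdiff F c"
    unfolding limiting_subdiff_def mem_Collect_eq
    using F_lim LIMSEQ_ignore_initial_segment[OF c, of N] LIMSEQ_ignore_initial_segment[OF u_lim, of N]
    by - (rule conjI, assumption, rule exI[of _ "\<lambda>k. x (k + N)"],
        rule exI[of _ "\<lambda>k. u (k + N)"], intro conjI; assumption)
  then show ?thesis
    using summable c by (auto simp: crit_def)
qed

section \<open>The asynchronous step as one proximal step\<close>

text \<open>After its last active clock \<open>a\<close> up to \<open>t\<close>, the block stays
  frozen, so at \<open>Suc t\<close> it is still the proximal point computed at
  \<open>a\<close>.\<close>

lemma mPAPG_last_update: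
  assumes gen: "mPAPG blk Df gs \<eta> T \<tau> x"
    and frequent: "T i \<inter> {t - s..t} \<noteq> {}"
  obtains a where "a \<le> t" "t \<le> a + s"
    "block blk i (x (Suc t)) \<in> prox_on (block_space blk i) (gs i) \<eta>
       (block blk i (x a) - \<eta> *\<^sub>R block blk i (Df (local_seq blk \<tau> x i a)))"
proof -
  define A where "A = T i \<inter> {t - s..t}"
  define a where "a = Max A"
  have A: "finite A" "A \<noteq> {}"
    using frequent by (simp_all add: A_def)
  then have "a \<in> A"
    unfolding a_def by (rule Max_in)
  then have a: "a \<in> T i" "a \<le> t" "t \<le> a + s"
    by (auto simp: A_def)
  have idle: "r \<notin> T i" if "a < r" "r \<le> t" for r
  proof
    assume "r \<in> T i"
    then have "r \<in> A"
      using that a by (simp add: A_def)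
    then have "r \<le> a"
      unfolding a_def by (rule Max_ge[OF A(1)])
    then show False
      using that by simp
  qed
  have same: "block blk i (x (Suc r)) = block blk i (x (Suc a))" if "r \<le> t" "a \<le> r" for r
    using that(2,1)
  proof (induction r rule: dec_induct)
    case (step r)
    then have "Suc r \<notin> T i"
      by (intro idle) auto
    then show ?case
      using gen step by (simp add: mPAPG_def)
  qed simp
  from a show ?thesis
    using gen same[of t] by (intro that[of a]) (auto simp: mPAPG_def)
qed

text \<open>Each coordinate of the local copy is taken from one iterate with clock between
  \<open>c\<close> and \<open>t\<close>, so the steps in between bound its deviation; summing over
  the coordinates gives the factor \<open>CARD('n)\<close>.\<close>

lemma local_seq_dist_le:
  fixes blk :: "'n::finite \<Rightarrow> 'p"
  assumes "\<And>j. c \<le> \<tau> i j a" "\<And>j. \<tau> i j a \<le> t"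
  shows "norm (x t - local_seq blk \<tau> x i a)
    \<le> real CARD('n) * (\<Sum>r\<in>{c..<t}. norm (x (Suc r) - x r))"
proof -
  have "norm (x t - local_seq blk \<tau> x i a) \<le> (\<Sum>k\<in>UNIV. \<bar>(x t - local_seq blk \<tau> x i a) $ k\<bar>)"
    by (rule norm_le_l1_cart)
  also have "\<dots> \<le> (\<Sum>k\<in>(UNIV :: 'n set). \<Sum>r\<in>{c..<t}. norm (x (Suc r) - x r))"
  proof (rule sum_mono)
    fix k
    let ?b = "\<tau> i (blk k) a"
    have "\<bar>(x t - local_seq blk \<tau> x i a) $ k\<bar> = \<bar>(x t - x ?b) $ k\<bar>"
      by (simp add: local_seq_def)
    also have "\<dots> \<le> norm (x t - x ?b)"
      by (rule component_le_norm_cart)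
    also have "\<dots> \<le> (\<Sum>r\<in>{?b..<t}. norm (x (Suc r) - x r))"
      by (rule norm_diff_le_sum_steps[OF assms(2)])
    also have "\<dots> \<le> (\<Sum>r\<in>{c..<t}. norm (x (Suc r) - x r))"
      using assms by (intro sum_mono2) auto
    finally show "\<bar>(x t - local_seq blk \<tau> x i a) $ k\<bar> \<le> (\<Sum>r\<in>{c..<t}. norm (x (Suc r) - x r))" .
  qed
  finally show ?thesis
    by simp
qed

text \<open>
  Block \<open>i\<close> of \<open>v\<close> is the forward step taken at the last active clock \<open>a i\<close> of machine \<open>i\<close>.
  Since \<open>g\<close> is separable, the blocks, although updated at different clocks, together form one
  proximal point of \<open>g\<close>.
\<close>

lemma mPAPG_prox_step:
  fixes blk :: "'n::finite \<Rightarrow> 'p::finite"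
  assumes sep: "\<And>y. g y = (\<Sum>i\<in>UNIV. gs i (block blk i y))"
    and lip: "L-lipschitz_on UNIV Df" and \<eta>: "0 < \<eta>"
    and delay: "\<And>i j t. \<tau> i j t \<le> t \<and> t - \<tau> i j t \<le> s"
    and frequent: "\<And>i t. T i \<inter> {t..t + s} \<noteq> {}"
    and gen: "mPAPG blk Df gs \<eta> T \<tau> x" and t: "s \<le> t"
  obtains v where "x (Suc t) \<in> prox_on UNIV g \<eta> v"
    "norm (Df (x (Suc t)) + (1 / \<eta>) *\<^sub>R (v - x (Suc t)))
      \<le> real CARD('n) * (L * real CARD('n) + 1 / \<eta>) *
        (\<Sum>r\<in>{Suc t - (2 * s + 1)..<Suc t}. norm (x (Suc r) - x r))"
proof -
  \<comment> \<open>The update condition looks forward from \<open>t - s\<close>; since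
    \<open>s \<le> t\<close>, its window ends exactly at \<open>t\<close>.\<close>
  have window: "T i \<inter> {t - s..t} \<noteq> {}" for i
    using frequent[of i "t - s"] t by simp
  have "\<exists>a. a \<le> t \<and> t \<le> a + s \<and> block blk i (x (Suc t)) \<in> prox_on (block_space blk i) (gs i) \<eta>
       (block blk i (x a) - \<eta> *\<^sub>R block blk i (Df (local_seq blk \<tau> x i a)))" for i
    using mPAPG_last_update[OF gen window] by metis
  then obtain a where a: "\<And>i. a i \<le> t" "\<And>i. t \<le> a i + s"
    and prox: "\<And>i. block blk i (x (Suc t)) \<in> prox_on (block_space blk i) (gs i) \<eta>
       (block blk i (x (a i)) - \<eta> *\<^sub>R block blk i (Df (local_seq blk \<tau> x i (a i))))"
    by metis
  define loc where "loc i = local_seq blk \<tau> x i (a i)" for i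
  define v where "v = (\<chi> k. x (a (blk k)) $ k - \<eta> * Df (loc (blk k)) $ k)"
  \<comment> \<open>The last active clock is up to \<open>s\<close> before \<open>t\<close>, the
    copies read then are up to \<open>s\<close> older, and the step from \<open>t\<close> to
    \<open>Suc t\<close> adds one.\<close>
  define S where "S = (\<Sum>r\<in>{Suc t - (2 * s + 1)..<Suc t}. norm (x (Suc r) - x r))"
  define u where "u = Df (x (Suc t)) + (1 / \<eta>) *\<^sub>R (v - x (Suc t))"
  have L: "0 \<le> L"
    using lip by (rule lipschitz_on_nonneg)
  have "block blk i v = block blk i (x (a i)) - \<eta> *\<^sub>R block blk i (Df (loc i))" for i
    by (simp add: block_def v_def vec_eq_iff)
  then have 1: "x (Suc t) \<in> prox_on UNIV g \<eta> v"
    using prox by (intro prox_on_separable[where g = g and gs = gs and blk = blk] sep) (simp add: loc_def)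
  have "\<bar>u $ k\<bar> \<le> L * (real CARD('n) * S) + 1 / \<eta> * S" for k
  proof -
    let ?i = "blk k"
    have "Suc t - (2 * s + 1) \<le> \<tau> ?i j (a ?i)" "\<tau> ?i j (a ?i) \<le> Suc t" for j
      using delay[of ?i j "a ?i"] a[of ?i] by auto
    then have "norm (x (Suc t) - loc ?i) \<le> real CARD('n) * S"
      unfolding S_def loc_def by (rule local_seq_dist_le)
    moreover have "norm (Df (x (Suc t)) - Df (loc ?i)) \<le> L * norm (x (Suc t) - loc ?i)"
      using lipschitz_onD[OF lip, of "x (Suc t)" "loc ?i"] by (simp add: dist_norm)
    ultimately have Df: "norm (Df (x (Suc t)) - Df (loc ?i)) \<le> L * (real CARD('n) * S)"
      using L by (meson mult_left_mono order_trans)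
    have "norm (x (Suc t) - x (a ?i)) \<le> (\<Sum>r\<in>{a ?i..<Suc t}. norm (x (Suc r) - x r))"
      using a by (intro norm_diff_le_sum_steps) (simp add: le_SucI)
    also have "\<dots> \<le> S"
      unfolding S_def using a[of ?i] by (intro sum_mono2) auto
    finally have x: "1 / \<eta> * norm (x (Suc t) - x (a ?i)) \<le> 1 / \<eta> * S"
      using \<eta> by (intro mult_left_mono) auto
    \<comment> \<open>Inserting the forward step leaves a gradient difference caused by stale copies
      and the displacement since the last active clock.\<close>
    have "u $ k = (Df (x (Suc t)) - Df (loc ?i)) $ k - 1 / \<eta> * (x (Suc t) - x (a ?i)) $ k"
      using \<eta> by (simp add: u_def v_def field_simps)
    also have "\<bar>\<dots>\<bar> \<le> \<bar>(Df (x (Suc t)) - Df (loc ?i)) $ k\<bar> + \<bar>1 / \<eta> * (x (Suc t) - x (a ?i)) $ k\<bar>"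
      by (rule abs_triangle_ineq4)
    also have "\<dots> = \<bar>(Df (x (Suc t)) - Df (loc ?i)) $ k\<bar> + 1 / \<eta> * \<bar>(x (Suc t) - x (a ?i)) $ k\<bar>"
      using \<eta> by (simp add: abs_mult)
    also have "\<dots> \<le> norm (Df (x (Suc t)) - Df (loc ?i)) + 1 / \<eta> * norm (x (Suc t) - x (a ?i))"
      using \<eta> by (intro add_mono mult_left_mono component_le_norm_cart) auto
    finally show ?thesis
      using Df x by linarith
  qed
  then have "(\<Sum>k\<in>UNIV. \<bar>u $ k\<bar>) \<le> (\<Sum>k\<in>(UNIV :: 'n set). L * (real CARD('n) * S) + 1 / \<eta> * S)"
    by (intro sum_mono)
  with norm_le_l1_cart[of u] have "norm u \<le> real CARD('n) * (L * (real CARD('n) * S) + 1 / \<eta> * S)"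
    by simp
  also have "\<dots> = real CARD('n) * (L * real CARD('n) + 1 / \<eta>) * S"
    by (simp add: algebra_simps)
  finally have "norm u \<le> real CARD('n) * (L * real CARD('n) + 1 / \<eta>) * S" .
  with 1 show ?thesis
    unfolding u_def S_def by (rule that)
qed

section \<open>Local sequences\<close>

lemma summable_window:
  fixes \<delta> :: "nat \<Rightarrow> real"
  assumes nonneg: "\<And>n. 0 \<le> \<delta> n" and "summable \<delta>"
  shows "summable (\<lambda>n. \<Sum>r\<in>{n - m..<n}. \<delta> r)"
proof (rule summableI_nonneg_bounded)
  show "0 \<le> (\<Sum>r\<in>{n - m..<n}. \<delta> r)" for n
    by (intro sum_nonneg nonneg)
  show "(\<Sum>n<M. \<Sum>r\<in>{n - m..<n}. \<delta> r) \<le> real m * suminf \<delta>" for M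
    by (intro order_trans[OF sum_window_le[OF nonneg]] mult_left_mono sum_le_suminf assms) auto
qed

text \<open>Both local copies are compared with \<open>x (Suc t)\<close>, so that the order of their
  clocks does not matter; the resulting windows inherit summability from the step lengths.\<close>

lemma summable_local_seq_steps:
  fixes blk :: "'n::finite \<Rightarrow> 'p"
  assumes delay: "\<And>j t. \<tau> i j t \<le> t \<and> t - \<tau> i j t \<le> s"
    and summable: "summable (\<lambda>t. norm (x (Suc t) - x t))"
  shows "summable (\<lambda>t. norm (local_seq blk \<tau> x i (Suc t) - local_seq blk \<tau> x i t))"
proof (rule summable_comparison_test', rule summable_mult)
  let ?S = "\<lambda>t. \<Sum>r\<in>{t - (s + 1)..<t}. norm (x (Suc r) - x r)"
  show "summable (\<lambda>t. ?S (Suc t))"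
    using summable_window[OF _ summable] summable_Suc_iff[of ?S] by simp
  fix t :: nat
  \<comment> \<open>A copy held at \<open>t\<close> may date from \<open>t - s\<close>, which is
    \<open>s + 1\<close> steps before \<open>Suc t\<close>.\<close>
  have D: "Suc t - (s + 1) \<le> \<tau> i j t" "\<tau> i j t \<le> Suc t"
    "Suc t - (s + 1) \<le> \<tau> i j (Suc t)" "\<tau> i j (Suc t) \<le> Suc t" for j
    using delay[of j t] delay[of j "Suc t"] by auto
  have "norm (local_seq blk \<tau> x i (Suc t) - local_seq blk \<tau> x i t)
    \<le> norm (x (Suc t) - local_seq blk \<tau> x i (Suc t)) + norm (x (Suc t) - local_seq blk \<tau> x i t)"
    using norm_triangle_ineq4[of "x (Suc t) - local_seq blk \<tau> x i t" "x (Suc t) - local_seq blk \<tau> x i (Suc t)"]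
    by simp
  also have "\<dots> \<le> real CARD('n) * ?S (Suc t) + real CARD('n) * ?S (Suc t)"
    using D by (intro add_mono local_seq_dist_le)
  finally show "norm (norm (local_seq blk \<tau> x i (Suc t) - local_seq blk \<tau> x i t))
      \<le> 2 * real CARD('n) * ?S (Suc t)"
    by simp
qed

lemma local_seq_tendsto:
  fixes blk :: "'n::finite \<Rightarrow> 'p"
  assumes delay: "\<And>j t. \<tau> i j t \<le> t \<and> t - \<tau> i j t \<le> s" and lim: "x \<longlonglongrightarrow> c"
  shows "local_seq blk \<tau> x i \<longlonglongrightarrow> c"
proof (rule vec_tendstoI)
  fix k
  have "filterlim (\<lambda>t. \<tau> i (blk k) t) at_top sequentially"
    unfolding filterlim_at_top eventually_sequentially
  proof (intro allI exI impI)
    fix Z t :: nat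
    assume "Z + s \<le> t"
    then show "Z \<le> \<tau> i (blk k) t"
      using delay[of "blk k" t] by arith
  qed
  from filterlim_compose[OF lim this]
  have "(\<lambda>t. x (\<tau> i (blk k) t) $ k) \<longlonglongrightarrow> c $ k"
    by (rule tendsto_vec_nth)
  then show "(\<lambda>t. local_seq blk \<tau> x i t $ k) \<longlonglongrightarrow> c $ k"
    by (simp add: local_seq_def)
qed

section \<open>From the algorithm to the abstract descent sequence\<close>

theorem theorem6p2:
  fixes blk :: "'n::finite \<Rightarrow> 'p::finite"
    and f :: "real ^ 'n \<Rightarrow> real" and Df :: "real ^ 'n \<Rightarrow> real ^ 'n"
    and g :: "real ^ 'n \<Rightarrow> ereal" and gs :: "'p \<Rightarrow> real ^ 'n \<Rightarrow> ereal"
    and F :: "real ^ 'n \<Rightarrow> ereal"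
    and T :: "'p \<Rightarrow> nat set" and \<tau> :: "'p \<Rightarrow> 'p \<Rightarrow> nat \<Rightarrow> nat" and s :: nat
    and L \<eta> :: real and x :: "nat \<Rightarrow> real ^ 'n"
  assumes grad: "\<And>y. GDERIV f y :> Df y"
    and g_proper: "proper_fun_on UNIV g" and g_closed: "closed_fun_on UNIV g"
    and gs_proper: "\<And>i. proper_fun_on (block_space blk i) (gs i)"
    and gs_closed: "\<And>i. closed_fun_on (block_space blk i) (gs i)"
    and F_def: "F = (\<lambda>y. ereal (f y) + g y)"
    and F_bounded_below: "\<exists>m::real. \<forall>y. ereal m \<le> F y"
    and L_pos: "L > 0" and grad_lipschitz: "L-lipschitz_on UNIV Df"
    and g_separable: "\<And>y. g y = (\<Sum>i\<in>UNIV. gs i (block blk i y))"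
    and delay: "\<And>i j t. \<tau> i j t \<le> t \<and> t - \<tau> i j t \<le> s"
    and no_self_delay: "\<And>i t. \<tau> i i t = t"
    and frequent_update: "\<And>i t. T i \<inter> {t..t + s} \<noteq> {}"
    and KL: "KL_property F"
    and step_size: "0 < \<eta>" "\<eta> < 1 / (L * (1 + 2 * sqrt (real CARD('p)) * real s))"
    and generated: "mPAPG blk Df gs \<eta> T \<tau> x"
    and sufficient_decrease: "\<exists>\<alpha>::real. \<alpha> > 0 \<and>
      (\<forall>\<^sub>F t in sequentially.
         F (x (Suc t)) \<le> F (x t) - ereal (\<alpha> * (norm (x (Suc t) - x t))\<^sup>2))"
    and bounded_seq: "bounded (range x)"
  shows "summable (\<lambda>t. norm (x (Suc t) - x t)) \<and>
    (\<forall>i. summable (\<lambda>t. norm (local_seq blk \<tau> x i (Suc t) - local_seq blk \<tau> x i t))) \<and>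
    (\<exists>c\<in>crit F. x \<longlonglongrightarrow> c \<and> (\<forall>i. local_seq blk \<tau> x i \<longlonglongrightarrow> c))"
proof -
  define C where "C = real CARD('n) * (L * real CARD('n) + 1 / \<eta>)"
  define m where "m = 2 * s + 1"
  \<comment> \<open>Every machine has an active clock in \<open>{0..s}\<close>, so from
    \<open>Suc s\<close> on all blocks of the iterate stem from proximal steps.\<close>
  have ex: "\<forall>t\<in>{Suc s..}. \<exists>v. x t \<in> prox_on UNIV g \<eta> v \<and> norm (Df (x t) + (1 / \<eta>) *\<^sub>R (v - x t))
      \<le> C * (\<Sum>r\<in>{t - m..<t}. norm (x (Suc r) - x r))"
  proof
    fix t
    assume t: "t \<in> {Suc s..}"
    obtain t' where t': "t = Suc t'" "s \<le> t'"
      using t by (cases t) auto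
    obtain v where "x (Suc t') \<in> prox_on UNIV g \<eta> v"
      "norm (Df (x (Suc t')) + (1 / \<eta>) *\<^sub>R (v - x (Suc t')))
        \<le> real CARD('n) * (L * real CARD('n) + 1 / \<eta>) *
          (\<Sum>r\<in>{Suc t' - (2 * s + 1)..<Suc t'}. norm (x (Suc r) - x r))"
      by (rule mPAPG_prox_step[OF g_separable grad_lipschitz step_size(1) delay frequent_update generated t'(2)])
    then show "\<exists>v. x t \<in> prox_on UNIV g \<eta> v \<and> norm (Df (x t) + (1 / \<eta>) *\<^sub>R (v - x t))
        \<le> C * (\<Sum>r\<in>{t - m..<t}. norm (x (Suc r) - x r))"
      unfolding t'(1) C_def m_def by blast
  qed
  obtain v where "\<forall>t\<in>{Suc s..}. x t \<in> prox_on UNIV g \<eta> (v t) \<and>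
      norm (Df (x t) + (1 / \<eta>) *\<^sub>R (v t - x t)) \<le> C * (\<Sum>r\<in>{t - m..<t}. norm (x (Suc r) - x r))"
    using bchoice[OF ex] ..
  then have v: "\<And>t. Suc s \<le> t \<Longrightarrow> x t \<in> prox_on UNIV g \<eta> (v t)"
    and small: "\<And>t. Suc s \<le> t \<Longrightarrow> norm (Df (x t) + (1 / \<eta>) *\<^sub>R (v t - x t))
      \<le> C * (\<Sum>r\<in>{t - m..<t}. norm (x (Suc r) - x r))"
    by simp_all
  obtain \<alpha> N0 where \<alpha>: "0 < \<alpha>" and decrease: "\<And>t. N0 \<le> t \<Longrightarrow>
      F (x (Suc t)) \<le> F (x t) - ereal (\<alpha> * (norm (x (Suc t) - x t))\<^sup>2)"
    using sufficient_decrease unfolding eventually_sequentially by blast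
  obtain b where b: "\<And>y. ereal b \<le> F y"
    using F_bounded_below by blast
  define N where "N = max (Suc s) N0"
  have N: "Suc s \<le> t" "N0 \<le> t" if "N \<le> t" for t
    using that by (auto simp: N_def)
  have gx: "g (x t) = ereal (real_of_ereal (g (x t)))" if "Suc s \<le> t" for t
    by (rule prox_on_finite_value[OF g_proper v[OF that]])
  have main: "summable (\<lambda>t. norm (x (Suc t) - x t)) \<and> (\<exists>c\<in>crit F. x \<longlonglongrightarrow> c)"
  \<comment> \<open>The slopes are \<open>(1 / \<eta>) *\<^sub>R (v t - x t)\<close> and the
    curvature is \<open>1 / (2 * \<eta>)\<close>, both read off from the proximal minorant;
    \<open>G t\<close> is the finite value of \<open>g\<close> at \<open>x t\<close>.\<close>
  proof (rule KL_descent_convergence[OF grad lipschitz_on_continuous_on[OF grad_lipschitz] g_closed F_def b KL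
        bounded_seq \<alpha>])
    show "0 \<le> C" "0 \<le> 1 / (2 * \<eta>)"
      using L_pos step_size(1) by (simp_all add: C_def)
    fix t
    assume "N \<le> t"
    note t = N[OF this]
    show "g (x t) = ereal (real_of_ereal (g (x t)))"
      by (rule gx[OF t(1)])
    show "F (x (Suc t)) \<le> F (x t) - ereal (\<alpha> * (norm (x (Suc t) - x t))\<^sup>2)"
      by (rule decrease[OF t(2)])
    show "norm (Df (x t) + (1 / \<eta>) *\<^sub>R (v t - x t)) \<le> C * (\<Sum>r\<in>{t - m..<t}. norm (x (Suc r) - x r))"
      by (rule small[OF t(1)])
    show "ereal (real_of_ereal (g (x t)) + ((1 / \<eta>) *\<^sub>R (v t - x t)) \<bullet> (z - x t)
        - 1 / (2 * \<eta>) * (norm (z - x t))\<^sup>2) \<le> g z" for z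
      by (rule prox_on_lower_bound[OF v[OF t(1)] gx[OF t(1)] step_size(1)])
  qed
  moreover have "summable (\<lambda>t. norm (local_seq blk \<tau> x i (Suc t) - local_seq blk \<tau> x i t))" for i
    using main by (intro summable_local_seq_steps[where s = s] delay) auto
  moreover have "local_seq blk \<tau> x i \<longlonglongrightarrow> c" if "x \<longlonglongrightarrow> c" for i c
    by (rule local_seq_tendsto[where s = s, OF _ that]) (rule delay)
  ultimately show ?thesis
    by blast
qed

end
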